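(* Let $\alpha$ be a real number. (1) If $\alpha\ge 2$, then for all $x\in[0,1]$, $$\frac{(\alpha+1)x}{\alpha+\sqrt{1-x^2}}\le\arcsin x\le\frac{(\pi\alpha/2)x}{\alpha+\sqrt{1-x^2}}.$$ (2) If $0<\alpha\le\frac{\pi}{2}$, then the reversed inequalities hold, that is, for all $x\in[0,1]$, $$\frac{(\pi\alpha/2)x}{\alpha+\sqrt{1-x^2}}\le\arcsin x\le\frac{(\alpha+1)x}{\alpha+\sqrt{1-x^2}}.$$ (3) If $\frac{\pi}{2}<\alpha<2$, then for all $x\in[0,1]$, $$\frac{4\bigl(1-1/\alpha^2\bigr)x}{\alpha+\sqrt{1-x^2}}\le\arcsin x\le\frac{\max\{\pi\alpha/2,\ \alpha+1\}\,x}{\alpha+\sqrt{1-x^2}}.$$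
   Context: Here $\arcsin:[-1,1]\to[-\pi/2,\pi/2]$ is the principal branch of the inverse sine function. *)

theory Defs
  imports Complex_Main
begin

end

theory Submission
  imports Defs "HOL-Analysis.Complex_Transcendental"
begin

text \<open>Put \<open>x = sin t\<close>. Every inequality compares \<open>t\<close> with \<open>c sin t / (\<alpha> + cos t)\<close> for a
  constant \<open>c\<close>, and the derivative of the difference has the sign of the monic quadratic
  \<open>u\<^sup>2 + (2 - c) \<alpha> u + (\<alpha>\<^sup>2 - c)\<close> at \<open>u = cos t\<close>. This quadratic is convex and takes the value
  \<open>(\<alpha> + 1) (\<alpha> + 1 - c)\<close> at \<open>u = 1\<close>; for \<open>c = \<alpha> + 1\<close> it factors, for \<open>c = 4 (1 - 1 / \<alpha>\<^sup>2)\<close> its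
  discriminant vanishes, and in the other cases convexity lets it change sign at most once on
  \<open>[0, 1]\<close>, so that the values of the difference at the two end points decide.\<close>

definition gap :: "real \<Rightarrow> real \<Rightarrow> real \<Rightarrow> real" where
  "gap \<alpha> c t = t - c * sin t / (\<alpha> + cos t)"

definition gap_quad :: "real \<Rightarrow> real \<Rightarrow> real \<Rightarrow> real" where
  "gap_quad \<alpha> c u = u\<^sup>2 + (2 - c) * \<alpha> * u + (\<alpha>\<^sup>2 - c)"

lemma gap_0 [simp]: "gap \<alpha> c 0 = 0"
  by (simp add: gap_def)

lemma gap_pi_half [simp]: "gap \<alpha> c (pi / 2) = pi / 2 - c / \<alpha>"
  by (simp add: gap_def)

lemma gap_quad_1: "gap_quad \<alpha> c 1 = (\<alpha> + 1) * (\<alpha> + 1 - c)"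
  by (simp add: gap_quad_def power2_eq_square algebra_simps)

lemma has_real_derivative_gap:
  assumes "\<alpha> + cos t \<noteq> 0"
  shows "(gap \<alpha> c has_real_derivative gap_quad \<alpha> c (cos t) / (\<alpha> + cos t)\<^sup>2) (at t)"
proof -
  have "((\<lambda>t. t - c * sin t / (\<alpha> + cos t)) has_real_derivative
      1 - (c * cos t * (\<alpha> + cos t) + c * sin t * sin t) / ((\<alpha> + cos t) * (\<alpha> + cos t))) (at t)"
    using assms by (auto intro!: derivative_eq_intros)
  moreover have "c * cos t * (\<alpha> + cos t) + c * sin t * sin t = c * (\<alpha> * cos t + 1)"
    by (simp add: algebra_simps flip: power2_eq_square distrib_left)
  moreover have "1 - c * (\<alpha> * cos t + 1) / ((\<alpha> + cos t) * (\<alpha> + cos t))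
      = gap_quad \<alpha> c (cos t) / (\<alpha> + cos t)\<^sup>2"
  proof -
    have "gap_quad \<alpha> c (cos t) = (\<alpha> + cos t) * (\<alpha> + cos t) - c * (\<alpha> * cos t + 1)"
      by (simp add: gap_quad_def power2_eq_square algebra_simps)
    then show ?thesis
      using assms by (simp add: power2_eq_square diff_divide_distrib)
  qed
  ultimately show ?thesis
    by (simp add: gap_def[abs_def])
qed

text \<open>Mean value theorem with the positive factors \<open>b - a\<close> and
  \<open>1 / (\<alpha> + cos s)\<^sup>2\<close> absorbed into \<open>k\<close>, so that the sign of
  an increment passes directly to the quadratic.\<close>

lemma gap_mvt:
  assumes "\<alpha> > 0" "0 \<le> a" "a < b" "b \<le> pi / 2"
  obtains s k where "a < s" "s < b" "k > 0" "gap \<alpha> c b - gap \<alpha> c a = k * gap_quad \<alpha> c (cos s)"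
proof -
  have pos: "\<alpha> + cos t > 0" if "a \<le> t" "t \<le> b" for t
    using assms that cos_ge_zero[of t] by linarith
  obtain s where s: "a < s" "s < b"
      "gap \<alpha> c b - gap \<alpha> c a = (b - a) * (gap_quad \<alpha> c (cos s) / (\<alpha> + cos s)\<^sup>2)"
    using MVT2[OF \<open>a < b\<close>, of "gap \<alpha> c" "\<lambda>t. gap_quad \<alpha> c (cos t) / (\<alpha> + cos t)\<^sup>2"]
      has_real_derivative_gap pos by (metis less_irrefl)
  show ?thesis
    using that[of s "(b - a) / (\<alpha> + cos s)\<^sup>2"] s pos[of s] \<open>a < b\<close> by simp
qed

text \<open>By convexity, the graph at \<open>v\<close> lies on or below the chord joining the
  points at \<open>u\<close> and \<open>w\<close>.\<close>

lemma gap_quad_pos_between: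
  assumes "u \<le> v" "v \<le> w" "gap_quad \<alpha> c v > 0"
  shows "gap_quad \<alpha> c u > 0 \<or> gap_quad \<alpha> c w > 0"
proof (rule ccontr)
  assume contra: "\<not> ?thesis"
  then have "gap_quad \<alpha> c u * (w - v) \<le> 0" "gap_quad \<alpha> c w * (v - u) \<le> 0"
    using assms by (auto simp: mult_le_0_iff)
  \<comment> \<open>Linear interpolation between \<open>u\<close> and \<open>w\<close>; the error
    term is exact because the quadratic is monic.\<close>
  moreover have "gap_quad \<alpha> c v * (w - u) =
      gap_quad \<alpha> c u * (w - v) + gap_quad \<alpha> c w * (v - u) - (w - v) * (v - u) * (w - u)"
    by (simp add: gap_quad_def power2_eq_square algebra_simps)
  moreover have "(w - v) * (v - u) * (w - u) \<ge> 0"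
    using assms by simp
  ultimately have "gap_quad \<alpha> c v * (w - u) \<le> 0"
    by linarith
  then have "u = v"
    using assms by (simp add: mult_le_0_iff)
  then show False
    using assms contra by simp
qed

lemma gap_nonneg_if_quad_nonneg:
  assumes "\<alpha> > 0" and quad: "\<And>u. 0 \<le> u \<Longrightarrow> u \<le> 1 \<Longrightarrow> gap_quad \<alpha> c u \<ge> 0"
    and t: "0 \<le> t" "t \<le> pi / 2"
  shows "gap \<alpha> c t \<ge> 0"
proof (cases "t = 0")
  case False
  then obtain s k where "0 < s" "s < t" "k > 0" "gap \<alpha> c t = k * gap_quad \<alpha> c (cos s)"
    using gap_mvt[of \<alpha> 0 t c] assms by auto
  then show ?thesis
    using quad[of "cos s"] cos_ge_zero[of s] t by simp
qed simp

text \<open>A positive value at \<open>t\<close> would force a rise from 0 to \<open>t\<close> and a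
  fall from \<open>t\<close> to \<open>pi / 2\<close>. As cosine decreases, the quadratic would then
  be negative at \<open>cos b\<close>, positive at \<open>cos a\<close> and, since
  \<open>\<alpha> + 1 \<le> c\<close>, nonpositive at 1, against convexity. The bound
  \<open>pi * \<alpha> / 2 \<le> c\<close> controls the end point \<open>pi / 2\<close>.\<close>

lemma gap_nonpos:
  assumes "\<alpha> > 0" "pi * \<alpha> / 2 \<le> c" "\<alpha> + 1 \<le> c" and t: "0 \<le> t" "t \<le> pi / 2"
  shows "gap \<alpha> c t \<le> 0"
proof (rule ccontr)
  assume pos: "\<not> ?thesis"
  have end_nonpos: "gap \<alpha> c (pi / 2) \<le> 0"
    using assms by (simp add: field_simps)
  have "0 < t" "t < pi / 2"
    using pos end_nonpos t by (cases "t = 0"; cases "t = pi / 2"; simp del: gap_pi_half)+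
  obtain a k where a: "0 < a" "a < t" "k > 0" "gap \<alpha> c t = k * gap_quad \<alpha> c (cos a)"
    using gap_mvt[of \<alpha> 0 t c] \<open>\<alpha> > 0\<close> \<open>0 < t\<close> t by auto
  obtain b l where b: "t < b" "b < pi / 2" "l > 0"
      "gap \<alpha> c (pi / 2) - gap \<alpha> c t = l * gap_quad \<alpha> c (cos b)"
    using gap_mvt[of \<alpha> t "pi / 2" c] \<open>\<alpha> > 0\<close> \<open>t < pi / 2\<close> t by (metis order_refl)
  have "gap_quad \<alpha> c (cos a) > 0"
    using pos a by (simp add: zero_less_mult_iff not_le)
  moreover have "l * gap_quad \<alpha> c (cos b) < 0"
    using pos end_nonpos b(4) by linarith
  then have "gap_quad \<alpha> c (cos b) < 0"
    using b(3) by (simp add: mult_less_0_iff)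
  moreover have "gap_quad \<alpha> c 1 \<le> 0"
    using assms by (simp add: gap_quad_1 mult_le_0_iff)
  moreover have "cos b \<le> cos a"
    using a b by (intro cos_monotone_0_pi_le) auto
  ultimately show False
    using gap_quad_pos_between[of "cos b" "cos a" 1 \<alpha> c] by simp
qed

text \<open>Mirror image of \<open>gap_nonpos\<close>: this constant makes the gap vanish at
  \<open>pi / 2\<close>, and a negative value would give a fall followed by a rise. The outer point
  for convexity is now 0, where the quadratic equals \<alpha> * (\<alpha> - pi / 2).\<close>

lemma gap_nonneg:
  assumes "0 < \<alpha>" "\<alpha> \<le> pi / 2" and t: "0 \<le> t" "t \<le> pi / 2"
  shows "gap \<alpha> (pi * \<alpha> / 2) t \<ge> 0"
proof (rule ccontr)
  define c where "c = pi * \<alpha> / 2"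
  assume "\<not> ?thesis"
  then have neg: "gap \<alpha> c t < 0"
    by (simp add: c_def)
  have end_0: "gap \<alpha> c (pi / 2) = 0"
    using assms by (simp add: c_def)
  have "0 < t" "t < pi / 2"
    using neg end_0 t by (cases "t = 0"; cases "t = pi / 2"; simp del: gap_pi_half)+
  obtain a k where a: "0 < a" "a < t" "k > 0" "gap \<alpha> c t = k * gap_quad \<alpha> c (cos a)"
    using gap_mvt[of \<alpha> 0 t c] \<open>\<alpha> > 0\<close> \<open>0 < t\<close> t by auto
  obtain b l where b: "t < b" "b < pi / 2" "l > 0"
      "gap \<alpha> c (pi / 2) - gap \<alpha> c t = l * gap_quad \<alpha> c (cos b)"
    using gap_mvt[of \<alpha> t "pi / 2" c] \<open>\<alpha> > 0\<close> \<open>t < pi / 2\<close> t by (metis order_refl)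
  have "gap_quad \<alpha> c (cos a) < 0"
    using neg a by (simp add: mult_less_0_iff)
  moreover have "l * gap_quad \<alpha> c (cos b) > 0"
    using neg end_0 b(4) by linarith
  then have "gap_quad \<alpha> c (cos b) > 0"
    using b(3) by (simp add: zero_less_mult_iff)
  moreover have "gap_quad \<alpha> c 0 \<le> 0"
    using assms by (simp add: gap_quad_def c_def power2_eq_square)
  moreover have "cos b \<le> cos a"
    using a b by (intro cos_monotone_0_pi_le) auto
  moreover have "0 \<le> cos b"
    using b \<open>0 < t\<close> by (intro cos_ge_zero) auto
  ultimately show False
    using gap_quad_pos_between[of 0 "cos b" "cos a" \<alpha> c] by simp
qed

lemma gap_nonneg_ge_2:
  assumes "\<alpha> \<ge> 2" and t: "0 \<le> t" "t \<le> pi / 2"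
  shows "gap \<alpha> (\<alpha> + 1) t \<ge> 0"
proof (rule gap_nonneg_if_quad_nonneg)
  fix u :: real
  assume "0 \<le> u" "u \<le> 1"
  \<comment> \<open>The roots are 1 and \<open>\<alpha> * \<alpha> - \<alpha> - 1\<close>; this
    makes the second at least 1, so both factors are nonpositive on [0, 1].\<close>
  have "2 * \<alpha> \<le> \<alpha> * \<alpha>"
    using assms by (intro mult_right_mono) auto
  then have "(u - 1) * (u - (\<alpha> * \<alpha> - \<alpha> - 1)) \<ge> 0"
    using \<open>u \<le> 1\<close> assms by (intro mult_nonpos_nonpos) linarith+
  then show "gap_quad \<alpha> (\<alpha> + 1) u \<ge> 0"
    by (simp add: gap_quad_def power2_eq_square algebra_simps)
qed (use assms in auto)

lemma gap_nonneg_double_root: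
  assumes "\<alpha> > 0" and t: "0 \<le> t" "t \<le> pi / 2"
  shows "gap \<alpha> (4 * (1 - 1 / \<alpha>\<^sup>2)) t \<ge> 0"
proof (rule gap_nonneg_if_quad_nonneg)
  fix u :: real
  have "gap_quad \<alpha> (4 * (1 - 1 / \<alpha>\<^sup>2)) u = (u - (\<alpha> - 2 / \<alpha>))\<^sup>2"
    using assms by (simp add: gap_quad_def power2_eq_square field_simps)
  then show "gap_quad \<alpha> (4 * (1 - 1 / \<alpha>\<^sup>2)) u \<ge> 0"
    by simp
qed (use assms in auto)

lemma arcsin_minus_eq_gap:
  assumes "x \<in> {0..1}"
  shows "arcsin x - c * x / (\<alpha> + sqrt (1 - x\<^sup>2)) = gap \<alpha> c (arcsin x)"
  using assms by (simp add: gap_def cos_arcsin)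

theorem theorem2:
  fixes \<alpha> :: real
  shows "(\<alpha> \<ge> 2 \<longrightarrow> (\<forall>x\<in>{0..1}.
            ((\<alpha> + 1) * x) / (\<alpha> + sqrt (1 - x\<^sup>2)) \<le> arcsin x \<and>
            arcsin x \<le> ((pi * \<alpha> / 2) * x) / (\<alpha> + sqrt (1 - x\<^sup>2)))) \<and>
         (0 < \<alpha> \<and> \<alpha> \<le> pi / 2 \<longrightarrow> (\<forall>x\<in>{0..1}.
            ((pi * \<alpha> / 2) * x) / (\<alpha> + sqrt (1 - x\<^sup>2)) \<le> arcsin x \<and>
            arcsin x \<le> ((\<alpha> + 1) * x) / (\<alpha> + sqrt (1 - x\<^sup>2)))) \<and>
         (pi / 2 < \<alpha> \<and> \<alpha> < 2 \<longrightarrow> (\<forall>x\<in>{0..1}.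
            (4 * (1 - 1 / \<alpha>\<^sup>2) * x) / (\<alpha> + sqrt (1 - x\<^sup>2)) \<le> arcsin x \<and>
            arcsin x \<le> (max (pi * \<alpha> / 2) (\<alpha> + 1) * x) / (\<alpha> + sqrt (1 - x\<^sup>2))))"
proof -
  have range: "0 \<le> arcsin x" "arcsin x \<le> pi / 2" if "x \<in> {0..1}" for x
    using that arcsin_le_arcsin[of 0 x] arcsin_ubound[of x] by auto
  have lower: "c * x / (\<alpha> + sqrt (1 - x\<^sup>2)) \<le> arcsin x"
    if "x \<in> {0..1}" "gap \<alpha> c (arcsin x) \<ge> 0" for c x
    using that arcsin_minus_eq_gap[of x c \<alpha>] by linarith
  have upper: "arcsin x \<le> c * x / (\<alpha> + sqrt (1 - x\<^sup>2))"
    if "x \<in> {0..1}" "\<alpha> > 0" "pi * \<alpha> / 2 \<le> c" "\<alpha> + 1 \<le> c" for c x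
    using that gap_nonpos[of \<alpha> c "arcsin x"] range[of x] arcsin_minus_eq_gap[of x c \<alpha>] by linarith
  have max_large: "\<alpha> + 1 \<le> pi * \<alpha> / 2" if "\<alpha> \<ge> 2"
  proof -
    \<comment> \<open>Half of this suffices, since 3 * \<alpha> / 2 \<ge> \<alpha> + 1 for \<alpha>
      \<ge> 2.\<close>
    have "3 * \<alpha> \<le> pi * \<alpha>"
      using that pi_gt3 by (intro mult_right_mono) auto
    then show ?thesis
      using that by linarith
  qed
  have max_small: "pi * \<alpha> / 2 \<le> \<alpha> + 1" if "0 < \<alpha>" "\<alpha> \<le> pi / 2"
  proof -
    \<comment> \<open>Precise enough: \<open>pi * \<alpha> / 2\<close> is at most 8 * \<alpha> / 5 =
      \<alpha> + 3 * \<alpha> / 5, and \<alpha> \<le> 8 / 5 bounds the last term by 24 / 25.\<close>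
    have "pi \<le> 16 / 5"
      using pi_approx by simp
    then have "\<alpha> * pi \<le> \<alpha> * (16 / 5)"
      using that by (intro mult_left_mono) auto
    moreover have "\<alpha> \<le> 8 / 5"
      using that \<open>pi \<le> 16 / 5\<close> by simp
    ultimately show ?thesis
      by (simp add: mult.commute)
  qed
  show ?thesis
  proof (intro conjI impI ballI)
    fix x :: real
    assume x: "x \<in> {0..1}"
    note t = range[OF x]
    { assume "\<alpha> \<ge> 2"
      then show "((\<alpha> + 1) * x) / (\<alpha> + sqrt (1 - x\<^sup>2)) \<le> arcsin x"
        using lower[OF x] gap_nonneg_ge_2 t by blast
      show "arcsin x \<le> ((pi * \<alpha> / 2) * x) / (\<alpha> + sqrt (1 - x\<^sup>2))"
        using \<open>\<alpha> \<ge> 2\<close> max_large by (intro upper[OF x]) auto }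
    { assume "0 < \<alpha> \<and> \<alpha> \<le> pi / 2"
      then show "((pi * \<alpha> / 2) * x) / (\<alpha> + sqrt (1 - x\<^sup>2)) \<le> arcsin x"
        using lower[OF x] gap_nonneg t by blast
      show "arcsin x \<le> ((\<alpha> + 1) * x) / (\<alpha> + sqrt (1 - x\<^sup>2))"
        using \<open>0 < \<alpha> \<and> \<alpha> \<le> pi / 2\<close> max_small by (intro upper[OF x]) auto }
    { assume "pi / 2 < \<alpha> \<and> \<alpha> < 2"
      then have "\<alpha> > 0"
        using pi_gt_zero by linarith
      then show "(4 * (1 - 1 / \<alpha>\<^sup>2) * x) / (\<alpha> + sqrt (1 - x\<^sup>2)) \<le> arcsin x"
        using lower[OF x] gap_nonneg_double_root t by blast
      show "arcsin x \<le> (max (pi * \<alpha> / 2) (\<alpha> + 1) * x) / (\<alpha> + sqrt (1 - x\<^sup>2))"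
        using \<open>\<alpha> > 0\<close> by (intro upper[OF x]) (auto simp: max_def) }
  qed
qed

end
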